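(* Let $A,B$ be positive definite complex $n\times n$ matrices, let $0<\tau<1$ and $0\leq t\leq 1$. If $t\leq r(\tau)$ or $t\geq R(\tau)$, then $$\det(A\nabla B)^{\frac{1}{n}}\geq \det(!_t(A,B))^{\frac{1}{n}}+\frac{t(1-t)}{\tau(1-\tau)}\det(A\nabla B-!_{\tau}(A,B))^{\frac{1}{n}}.$$
   Context: For positive definite $A,B$ and $0\le t\le1$: $A!_tB=((1-t)A^{-1}+tB^{-1})^{-1}$, $A\nabla B=\frac{A+B}{2}$, and the harmonic Heinz mean is $!_t(A,B)=\frac{A!_tB+A!_{1-t}B}{2}$. For $0\le\tau\le1$, $r(\tau)=\min\{\tau,1-\tau\}$ and $R(\tau)=\max\{\tau,1-\tau\}$. Here $\det(C)^{1/n}$ means $(\det C)^{1/n}$, the nonnegative $n$-th root (all matrices involved are positive semidefinite). *)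

theory Defs
  imports "HOL-Analysis.Analysis"
begin

definition conj_transpose :: "complex ^ 'n ^ 'm \<Rightarrow> complex ^ 'm ^ 'n" where
  "conj_transpose A = map_matrix cnj (transpose A)"

definition hermitian :: "complex ^ 'n ^ 'n \<Rightarrow> bool" where
  "hermitian A \<longleftrightarrow> conj_transpose A = A"

(* For hermitian A the form x* A x is real, so Re only adjusts the type. *)
definition pos_definite :: "complex ^ 'n ^ 'n \<Rightarrow> bool" where
  "pos_definite A \<longleftrightarrow>
     hermitian A \<and> (\<forall>x. x \<noteq> 0 \<longrightarrow> Re (\<Sum>i\<in>UNIV. cnj (x $ i) * (A *v x) $ i) > 0)"

definition arith_mean :: "complex ^ 'n ^ 'n \<Rightarrow> complex ^ 'n ^ 'n \<Rightarrow> complex ^ 'n ^ 'n" where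
  "arith_mean A B = (1 / 2) *\<^sub>R (A + B)"

definition harmonic_mean ::
    "real \<Rightarrow> complex ^ 'n ^ 'n \<Rightarrow> complex ^ 'n ^ 'n \<Rightarrow> complex ^ 'n ^ 'n" where
  "harmonic_mean t A B = matrix_inv ((1 - t) *\<^sub>R matrix_inv A + t *\<^sub>R matrix_inv B)"

definition harmonic_heinz_mean ::
    "real \<Rightarrow> complex ^ 'n ^ 'n \<Rightarrow> complex ^ 'n ^ 'n \<Rightarrow> complex ^ 'n ^ 'n" where
  "harmonic_heinz_mean t A B = (1 / 2) *\<^sub>R (harmonic_mean t A B + harmonic_mean (1 - t) A B)"

definition r_min :: "real \<Rightarrow> real" where
  "r_min \<tau> = min \<tau> (1 - \<tau>)"

definition R_max :: "real \<Rightarrow> real" where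
  "R_max \<tau> = max \<tau> (1 - \<tau>)"

(* The nonnegative n-th root of det C for positive semidefinite C, whose determinant is
   a nonnegative real, so that Re only adjusts the type. *)
definition det_root :: "complex ^ 'n ^ 'n \<Rightarrow> real" where
  "det_root C = root CARD('n) (Re (det C))"

end

theory Submission
  imports Defs
begin

text \<open>
  Two positive definite matrices are simultaneously congruent to diagonal matrices:
  \<open>A = S\<^sup>* S\<close> and \<open>B = S\<^sup>* D S\<close> with \<open>S\<close> invertible and \<open>D = diag(d\<^sub>i)\<close>, \<open>d\<^sub>i > 0\<close>
  (\<open>simultaneous_diagonalization\<close>). Means of matrices commute with congruence, so the
  arithmetic mean, the two harmonic Heinz means and their differences are all of the
  form \<open>S\<^sup>* diag(c\<^sub>i) S\<close>, where the \<open>c\<^sub>i\<close> are the corresponding expressions in the numbers \<open>1\<close>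
  and \<open>d\<^sub>i\<close>. The root of the determinant of such a matrix is the geometric mean of the
  \<open>c\<^sub>i\<close> times a factor that depends on \<open>S\<close> only.

  What remains is a scalar inequality and a property of the geometric mean. With
  \<open>s = t (1 - t)\<close>, the harmonic Heinz mean of \<open>1\<close> and \<open>x\<close> is the arithmetic mean times
  \<open>x / (x + s (x - 1)\<^sup>2)\<close>, and its relative gap to the arithmetic mean is
  \<open>s (x - 1)\<^sup>2 / (x + s (x - 1)\<^sup>2)\<close>. This gap divided by \<open>s\<close> is nonincreasing in \<open>s\<close>, and the
  hypothesis on \<open>t\<close> and \<open>\<tau>\<close> gives \<open>t (1 - t) \<le> \<tau> (1 - \<tau>)\<close> (\<open>weight_product_mono\<close>); hence
  the claimed inequality holds for numbers (\<open>arith_harmonic_heinz_gap_antimono\<close>). It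
  passes to geometric means because these are monotone, homogeneous and superadditive (\<open>root_prod_superadditive\<close>), the
  diagonal case of Minkowski's determinant inequality.

  The diagonalization is obtained from a variational argument: a vector that
  maximizes the quotient of the two quadratic forms on a subspace \<open>U\<close> is such that its
  orthogonal complement in \<open>U\<close> for the form of \<open>A\<close> is also orthogonal to it for the form
  of \<open>B\<close>. Splitting off one such vector at a time gives a basis that is orthonormal for
  \<open>A\<close> and orthogonal for \<open>B\<close>.
\<close>

section \<open>Sesquilinear forms of complex matrices\<close>

lemma conj_transpose_nth: "conj_transpose M $ i $ j = cnj (M $ j $ i)"
  by (simp add: conj_transpose_def transpose_def map_matrix_def)

definition sesqui :: "complex ^ 'n ^ 'n \<Rightarrow> complex ^ 'n \<Rightarrow> complex ^ 'n \<Rightarrow> complex" where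
  "sesqui M x y = (\<Sum>i\<in>UNIV. cnj (x $ i) * (M *v y) $ i)"

lemma sesqui_altdef: "sesqui M x y = (\<Sum>i\<in>UNIV. \<Sum>j\<in>UNIV. cnj (x $ i) * M $ i $ j * y $ j)"
  by (simp add: sesqui_def matrix_vector_mult_def sum_distrib_left mult.assoc)

lemma sesqui_add_left: "sesqui M (x + y) z = sesqui M x z + sesqui M y z"
  by (simp add: sesqui_def sum.distrib algebra_simps)

lemma sesqui_add_right: "sesqui M x (y + z) = sesqui M x y + sesqui M x z"
  by (simp add: sesqui_def sum.distrib algebra_simps)

lemma sesqui_scale_left: "sesqui M (c *s x) y = cnj c * sesqui M x y"
  by (simp add: sesqui_def sum_distrib_left mult.assoc)

lemma sesqui_scale_right: "sesqui M x (c *s y) = c * sesqui M x y"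
  by (simp add: sesqui_altdef sum_distrib_left mult_ac)

lemma cnj_sesqui:
  assumes "hermitian M"
  shows "cnj (sesqui M x y) = sesqui M y x"
proof -
  have M: "cnj (M $ i $ j) = M $ j $ i" for i j
    using assms conj_transpose_nth[of M j i] by (simp add: hermitian_def)
  have "cnj (sesqui M x y) = (\<Sum>i\<in>UNIV. \<Sum>j\<in>UNIV. cnj (y $ j) * M $ j $ i * x $ i)"
    by (simp add: sesqui_altdef M mult_ac)
  also have "\<dots> = sesqui M y x"
    unfolding sesqui_altdef by (rule sum.swap)
  finally show ?thesis .
qed

lemma sesqui_self_real:
  assumes "hermitian M"
  shows "sesqui M x x = of_real (Re (sesqui M x x))"
  using cnj_sesqui[OF assms, of x x] by (simp add: Reals_cnj_iff)

lemma continuous_on_sesqui: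
  "continuous_on S f \<Longrightarrow> continuous_on S g \<Longrightarrow> continuous_on S (\<lambda>x. sesqui M (f x) (g x))"
  unfolding sesqui_altdef by (intro continuous_intros)

section \<open>Bases orthogonal for two forms\<close>

text \<open>
  The first-order condition at a minimum: a real quadratic that vanishes at \<open>0\<close> and is
  nowhere negative has derivative \<open>0\<close> there.
\<close>
lemma linear_coefficient_zero:
  fixes a b :: real
  assumes "\<And>s. 0 \<le> a * s + b * s\<^sup>2"
  shows "a = 0"
proof (rule ccontr)
  assume "a \<noteq> 0"
  \<comment> \<open>Replacing \<open>b\<close> by a positive bound makes \<open>s = - a / c\<close> a usable test point even if \<open>b \<le> 0\<close>.\<close>
  define c where "c = \<bar>b\<bar> + 1"
  have c: "c > 0" "b < c" by (auto simp: c_def)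
  have "0 \<le> a * (- a / c) + b * (- a / c)\<^sup>2" by (rule assms)
  also have "\<dots> = (a / c)\<^sup>2 * (b - c)"
    using c by (simp add: field_simps power2_eq_square)
  also have "\<dots> < 0" using c \<open>a \<noteq> 0\<close> by (intro mult_pos_neg) auto
  finally show False by simp
qed

text \<open>
  Let \<open>w\<close> maximize the quotient of the forms of \<open>B\<close> and \<open>A\<close> over the nonzero vectors of \<open>U\<close>, and
  let \<open>c\<close> be the maximum. Then the form of \<open>c A - B\<close> is nonnegative on \<open>U\<close> and vanishes at \<open>w\<close>.
  Its first variation at \<open>w\<close> therefore vanishes in all directions of \<open>U\<close>, which is the
  claim for \<open>w\<close>. Scaling \<open>w\<close> gives the normalization.
\<close>
lemma exists_orthogonality_preserving_vector:
  fixes A B :: "complex ^ 'n ^ 'n"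
  assumes A: "pos_definite A" and B: "hermitian B"
    and U: "vec.subspace U" "closed U" and "u \<in> U" "u \<noteq> 0"
  shows "\<exists>x\<in>U. sesqui A x x = 1 \<and> (\<forall>y\<in>U. sesqui A x y = 0 \<longrightarrow> sesqui B x y = 0)"
proof -
  have hA: "hermitian A" and posA: "\<And>x. x \<noteq> 0 \<Longrightarrow> Re (sesqui A x x) > 0"
    using A by (auto simp: pos_definite_def sesqui_def)
  have scale: "Re (sesqui M (of_real c *s y) (of_real c *s y)) = c\<^sup>2 * Re (sesqui M y y)"
    for M :: "complex ^ 'n ^ 'n" and c y
    by (simp add: sesqui_scale_left sesqui_scale_right power2_eq_square)
  have scaleR: "of_real c *s y = c *\<^sub>R y" for c and y :: "complex ^ 'n"
    by (simp add: vec_eq_iff) (simp add: scaleR_conv_of_real)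
  \<comment> \<open>The quotient is invariant under scaling, so it suffices to maximize over unit vectors.\<close>
  define K where "K = sphere 0 1 \<inter> U"
  define f where "f y = Re (sesqui B y y) / Re (sesqui A y y)" for y
  have normalize: "of_real (1 / norm y) *s y \<in> K" if "y \<in> U" "y \<noteq> 0" for y
  proof -
    have "of_real (1 / norm y) *s y \<in> U"
      using that U(1) by (intro vec.subspace_scale)
    moreover have "norm (of_real (1 / norm y) *s y) = 1"
      unfolding scaleR using that by simp
    ultimately show ?thesis by (simp add: K_def)
  qed
  have "compact K" unfolding K_def using U(2) by (intro compact_Int_closed) auto
  moreover have "K \<noteq> {}" using normalize[OF \<open>u \<in> U\<close> \<open>u \<noteq> 0\<close>] by auto
  moreover have "continuous_on K f"
  proof -
    have "Re (sesqui A y y) \<noteq> 0" if "y \<in> K" for y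
      using posA[of y] that by (cases "y = 0") (auto simp: K_def)
    then show ?thesis
      unfolding f_def by (intro continuous_intros continuous_on_sesqui) auto
  qed
  ultimately obtain w where w: "w \<in> K" and wmax: "\<And>y. y \<in> K \<Longrightarrow> f y \<le> f w"
    using continuous_attains_sup[of K f] by blast
  have w0: "w \<noteq> 0" and wU: "w \<in> U" using w by (auto simp: K_def)
  have bound: "Re (sesqui B y y) \<le> f w * Re (sesqui A y y)" if "y \<in> U" for y
  proof (cases "y = 0")
    case True
    then show ?thesis by (simp add: sesqui_altdef)
  next
    case False
    have "f (of_real (1 / norm y) *s y) = f y"
      unfolding f_def scale using False by simp
    then have "f y \<le> f w" using wmax[OF normalize[OF that False]] by simp
    then show ?thesis using posA[OF False] by (simp add: f_def field_simps)
  qed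
  have fw: "Re (sesqui B w w) = f w * Re (sesqui A w w)"
    using posA[OF w0] by (simp add: f_def)
  have Re0: "Re (sesqui B w z) = 0" if z: "z \<in> U" "sesqui A w z = 0" for z
  proof -
    have expand: "Re (sesqui M (w + of_real s *s z) (w + of_real s *s z))
        = Re (sesqui M w w) + 2 * s * Re (sesqui M w z) + s\<^sup>2 * Re (sesqui M z z)"
      if "hermitian M" for M :: "complex ^ 'n ^ 'n" and s
    proof -
      have "Re (sesqui M z w) = Re (sesqui M w z)"
        using arg_cong[OF cnj_sesqui[OF that, of w z], of Re] by simp
      then show ?thesis
        by (simp add: sesqui_add_left sesqui_add_right sesqui_scale_left sesqui_scale_right
            power2_eq_square algebra_simps)
    qed
    have "0 \<le> (- 2 * Re (sesqui B w z)) * s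
        + (f w * Re (sesqui A z z) - Re (sesqui B z z)) * s\<^sup>2" for s
    proof -
      have "w + of_real s *s z \<in> U"
        using U(1) wU z by (intro vec.subspace_add vec.subspace_scale)
      from bound[OF this] show ?thesis
        unfolding expand[OF hA] expand[OF B] using z(2) fw by (simp add: algebra_simps)
    qed
    from linear_coefficient_zero[OF this] show ?thesis by simp
  qed
  \<comment> \<open>Real directions control only the real part; the direction \<open>\<i> z\<close> gives the imaginary part.\<close>
  have orth: "sesqui B w z = 0" if z: "z \<in> U" "sesqui A w z = 0" for z
  proof -
    have "\<i> *s z \<in> U" using U(1) z by (intro vec.subspace_scale)
    then have "Re (sesqui B w (\<i> *s z)) = 0"
      by (intro Re0) (auto simp: sesqui_scale_right z)
    then show ?thesis using Re0[OF z] by (simp add: complex_eq_iff sesqui_scale_right)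
  qed
  define c where "c = 1 / sqrt (Re (sesqui A w w))"
  have c: "c > 0" "c\<^sup>2 * Re (sesqui A w w) = 1"
    using posA[OF w0] by (auto simp: c_def power_divide)
  show ?thesis
  proof (intro bexI conjI ballI impI)
    show "of_real c *s w \<in> U" using U(1) wU by (intro vec.subspace_scale)
    show "sesqui A (of_real c *s w) (of_real c *s w) = 1"
      using c(2) by (subst sesqui_self_real[OF hA]) (simp only: scale of_real_1)
    fix y assume "y \<in> U" "sesqui A (of_real c *s w) y = 0"
    then show "sesqui B (of_real c *s w) y = 0"
      using orth[of y] c(1) by (simp add: sesqui_scale_left)
  qed
qed

text \<open>
  The conditions form a homogeneous linear system with fewer equations than unknowns.
  Padding it with zero rows gives a square matrix of determinant \<open>0\<close>; this is why the
  vectors are indexed by a proper subset of the coordinates.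
\<close>
lemma exists_nonzero_orthogonal:
  fixes A :: "complex ^ 'n ^ 'n" and I :: "'n set"
  assumes "k \<notin> I"
  shows "\<exists>u. u \<noteq> 0 \<and> (\<forall>i\<in>I. sesqui A (v i) u = 0)"
proof -
  define M :: "complex ^ 'n ^ 'n" where
    "M = (\<chi> i j. if i \<in> I then \<Sum>l\<in>UNIV. cnj (v i $ l) * A $ l $ j else 0)"
  have M: "(M *v u) $ i = sesqui A (v i) u" if "i \<in> I" for i u
    using that
    by (simp add: M_def matrix_vector_mult_def sesqui_altdef sum_distrib_right)
      (rule sum.swap)
  have "row k M = 0" using assms by (simp add: row_def M_def vec_eq_iff)
  then have "det M = 0" by (rule det_zero_row)
  then have "\<not> invertible M" by (simp add: invertible_det_nz)
  then obtain u where "u \<noteq> 0" "M *v u = 0"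
    by (metis invertible_left_inverse matrix_left_invertible_ker)
  then show ?thesis using M by (metis zero_index)
qed

text \<open>
  The induction needs the third conjunct: it guarantees that the next vector, chosen
  orthogonal for \<open>A\<close> to those already found, is orthogonal to them for \<open>B\<close> too. It
  survives the addition of a vector that maximizes on the whole orthogonal complement.
\<close>
lemma exists_partial_diagonalizing_family:
  fixes A B :: "complex ^ 'n ^ 'n" and I :: "'n set"
  assumes A: "pos_definite A" and B: "hermitian B"
  shows "\<exists>v. (\<forall>i\<in>I. \<forall>j\<in>I. sesqui A (v i) (v j) = (if i = j then 1 else 0))
    \<and> (\<forall>i\<in>I. \<forall>j\<in>I. i \<noteq> j \<longrightarrow> sesqui B (v i) (v j) = 0)
    \<and> (\<forall>y. (\<forall>i\<in>I. sesqui A (v i) y = 0) \<longrightarrow> (\<forall>i\<in>I. sesqui B (v i) y = 0))"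
  using finite[of I]
proof (induction I)
  case empty
  show ?case by simp
next
  case (insert k I)
  from insert.IH obtain v where
    v: "\<forall>i\<in>I. \<forall>j\<in>I. sesqui A (v i) (v j) = (if i = j then 1 else 0)"
      "\<forall>i\<in>I. \<forall>j\<in>I. i \<noteq> j \<longrightarrow> sesqui B (v i) (v j) = 0"
      "\<forall>y. (\<forall>i\<in>I. sesqui A (v i) y = 0) \<longrightarrow> (\<forall>i\<in>I. sesqui B (v i) y = 0)"
    by (elim exE conjE)
  define U where "U = {y. \<forall>i\<in>I. sesqui A (v i) y = 0}"
  have hA: "hermitian A" using A by (simp add: pos_definite_def)
  have "vec.subspace U"
    unfolding vec.subspace_def U_def
    by (auto simp: sesqui_add_right sesqui_scale_right) (simp add: sesqui_altdef)
  moreover have "closed U"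
  proof -
    have "U = (\<Inter>i\<in>I. {y. sesqui A (v i) y = 0})" by (auto simp: U_def)
    then show ?thesis
      by (auto intro!: closed_Collect_eq continuous_on_sesqui continuous_intros)
  qed
  moreover obtain u where "u \<in> U" "u \<noteq> 0"
    using exists_nonzero_orthogonal[OF insert.hyps(2), of A v] by (auto simp: U_def)
  ultimately obtain x where x: "x \<in> U" "sesqui A x x = 1"
    and xU: "\<And>y. y \<in> U \<Longrightarrow> sesqui A x y = 0 \<Longrightarrow> sesqui B x y = 0"
    using exists_orthogonality_preserving_vector[OF A B] by blast
  have xA: "sesqui A (v i) x = 0" "sesqui A x (v i) = 0" if "i \<in> I" for i
    using x(1) that cnj_sesqui[OF hA, of "v i" x] by (auto simp: U_def)
  have xB: "sesqui B (v i) x = 0" "sesqui B x (v i) = 0" if "i \<in> I" for i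
    using v(3) that x(1) cnj_sesqui[OF B, of "v i" x] by (auto simp: U_def)
  have k: "i \<noteq> k" if "i \<in> I" for i using that insert.hyps(2) by auto
  show ?case
  proof (intro exI[of _ "v(k := x)"] conjI ballI allI impI)
    fix i j
    assume "i \<in> insert k I" "j \<in> insert k I"
    then show "sesqui A ((v(k := x)) i) ((v(k := x)) j) = (if i = j then 1 else 0)"
      using v(1) x(2) xA k by auto
  next
    fix i j
    assume "i \<in> insert k I" "j \<in> insert k I" "i \<noteq> j"
    then show "sesqui B ((v(k := x)) i) ((v(k := x)) j) = 0"
      using v(2) xB k by auto
  next
    fix y i
    assume y: "\<forall>i\<in>insert k I. sesqui A ((v(k := x)) i) y = 0" and i: "i \<in> insert k I"
    have "\<forall>i\<in>I. sesqui A (v i) y = 0"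
    proof
      fix i assume "i \<in> I"
      then show "sesqui A (v i) y = 0" using bspec[OF y, of i] k[of i] by simp
    qed
    moreover have "sesqui A x y = 0" using bspec[OF y, of k] by simp
    ultimately show "sesqui B ((v(k := x)) i) y = 0"
      using i v(3) xU[of y] k[of i] by (auto simp: U_def)
  qed
qed

section \<open>Simultaneous diagonalization by congruence\<close>

definition diag_mat :: "('n \<Rightarrow> real) \<Rightarrow> complex ^ 'n ^ 'n" where
  "diag_mat d = (\<chi> i j. if i = j then of_real (d i) else 0)"

text \<open>
  For fixed \<open>S\<close> the linear operations act on the diagonal entries. Inversion leads to the
  same form for another matrix in place of \<open>S\<close>, and a second inversion leads back.
\<close>
definition congruent_diag :: "complex ^ 'n ^ 'n \<Rightarrow> ('n \<Rightarrow> real) \<Rightarrow> complex ^ 'n ^ 'n" where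
  "congruent_diag S d = conj_transpose S ** diag_mat d ** S"

lemma conj_transpose_mult: "conj_transpose (M ** N) = conj_transpose N ** conj_transpose M"
  by (simp add: vec_eq_iff conj_transpose_nth matrix_matrix_mult_def mult.commute)

lemma conj_transpose_conj_transpose: "conj_transpose (conj_transpose M) = M"
  by (simp add: vec_eq_iff conj_transpose_nth)

lemma conj_transpose_mat_1: "conj_transpose (mat 1) = mat 1"
  by (simp add: vec_eq_iff conj_transpose_nth mat_def)

lemma det_conj_transpose: "det (conj_transpose M) = cnj (det M)"
proof -
  have "det (conj_transpose M) = det (map_matrix cnj M)"
    unfolding conj_transpose_def
    by (subst det_transpose[symmetric]) (simp add: transpose_def map_matrix_def vec_eq_iff)
  also have "\<dots> = cnj (det M)" by (simp add: det_def)
  finally show ?thesis .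
qed

lemma diag_mat_mult: "diag_mat c ** diag_mat d = diag_mat (\<lambda>i. c i * d i)"
  by (simp add: vec_eq_iff diag_mat_def matrix_matrix_mult_def
      if_distrib[of "\<lambda>x. x * _"] cong: if_cong)

lemma diag_mat_1: "diag_mat (\<lambda>_. 1) = mat 1"
  by (simp add: vec_eq_iff diag_mat_def mat_def)

lemma congruent_diag_nth:
  "congruent_diag S d $ i $ j = (\<Sum>k\<in>UNIV. of_real (d k) * (cnj (S $ k $ i) * S $ k $ j))"
  by (simp add: congruent_diag_def matrix_matrix_mult_def conj_transpose_nth diag_mat_def
      if_distrib[of "\<lambda>x. _ * x"] mult_ac cong: if_cong)

lemma congruent_diag_add:
  "congruent_diag S c + congruent_diag S d = congruent_diag S (\<lambda>i. c i + d i)"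
  by (simp add: vec_eq_iff congruent_diag_nth sum.distrib algebra_simps)

lemma congruent_diag_diff:
  "congruent_diag S c - congruent_diag S d = congruent_diag S (\<lambda>i. c i - d i)"
  by (simp add: vec_eq_iff congruent_diag_nth sum_subtractf algebra_simps)

lemma congruent_diag_scaleR: "a *\<^sub>R congruent_diag S d = congruent_diag S (\<lambda>i. a * d i)"
  by (simp add: vec_eq_iff congruent_diag_nth) (simp add: scaleR_conv_of_real sum_distrib_left mult_ac)

lemma matrix_inv_eqI:
  fixes M N :: "'a::field ^ 'n ^ 'n"
  assumes MN: "M ** N = mat 1"
  shows "matrix_inv M = N"
  unfolding matrix_inv_def
proof (rule some_equality)
  have "N ** M = mat 1" by (rule matrix_left_right_inverse[THEN iffD1, OF MN])
  with MN show "M ** N = mat 1 \<and> N ** M = mat 1" ..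
next
  fix X
  assume "M ** X = mat 1 \<and> X ** M = mat 1"
  then have "X ** M = mat 1" ..
  have "X = X ** (M ** N)" by (simp only: MN matrix_mul_rid)
  also have "\<dots> = N" by (simp only: matrix_mul_assoc \<open>X ** M = mat 1\<close> matrix_mul_lid)
  finally show "X = N" .
qed

lemma matrix_inv_congruent_diag:
  assumes VS: "V ** S = mat 1" and d: "\<And>i. d i \<noteq> 0"
  shows "matrix_inv (congruent_diag S d) = congruent_diag (conj_transpose V) (\<lambda>i. 1 / d i)"
    (is "matrix_inv ?M = ?N")
proof -
  have SV: "S ** V = mat 1" by (rule matrix_left_right_inverse[THEN iffD1, OF VS])
  have VS': "conj_transpose S ** conj_transpose V = mat 1"
    by (simp add: VS conj_transpose_mat_1 flip: conj_transpose_mult)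
  have "?M ** ?N = conj_transpose S ** diag_mat d ** (S ** V)
      ** diag_mat (\<lambda>i. 1 / d i) ** conj_transpose V"
    by (simp add: congruent_diag_def conj_transpose_conj_transpose matrix_mul_assoc)
  also have "\<dots> = conj_transpose S ** (diag_mat d ** diag_mat (\<lambda>i. 1 / d i)) ** conj_transpose V"
    by (simp add: SV matrix_mul_assoc)
  also have "\<dots> = conj_transpose S ** conj_transpose V"
    by (simp add: diag_mat_mult d diag_mat_1)
  also note VS'
  finally show ?thesis by (rule matrix_inv_eqI)
qed

lemma det_congruent_diag:
  "det (congruent_diag S d) = of_real ((cmod (det S))\<^sup>2 * (\<Prod>i\<in>UNIV. d i))"
proof -
  have "det (diag_mat d) = of_real (\<Prod>i\<in>UNIV. d i)"
    by (subst det_diagonal) (auto simp: diag_mat_def)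
  then show ?thesis
    unfolding congruent_diag_def det_mul det_conj_transpose
    using complex_norm_square[of "det S"] by (simp add: mult_ac)
qed

lemma det_root_congruent_diag:
  fixes S :: "complex ^ 'n ^ 'n"
  shows "det_root (congruent_diag S d) =
    root CARD('n) ((cmod (det S))\<^sup>2) * root CARD('n) (\<Prod>i\<in>UNIV. d i)"
  unfolding det_root_def det_congruent_diag Re_complex_of_real by (rule real_root_mult)

text \<open>
  If \<open>V\<close> has the diagonalizing family as columns, then \<open>V\<^sup>* A V = 1\<close> and \<open>V\<^sup>* B V\<close> is diagonal.
  The first equation shows that \<open>V\<^sup>* A\<close> is the inverse of \<open>V\<close>, and multiplying both equations
  by this inverse from the right and by its adjoint from the left recovers \<open>A\<close> and \<open>B\<close>.
\<close>
lemma simultaneous_diagonalization: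
  fixes A B :: "complex ^ 'n ^ 'n"
  assumes A: "pos_definite A" and B: "pos_definite B"
  obtains S V d where "V ** S = mat 1" "A = congruent_diag S (\<lambda>_. 1)" "B = congruent_diag S d"
    "\<And>i. d i > 0"
proof -
  have hB: "hermitian B" and posB: "\<And>x. x \<noteq> 0 \<Longrightarrow> Re (sesqui B x x) > 0"
    using B by (auto simp: pos_definite_def sesqui_def)
  obtain v :: "'n \<Rightarrow> complex ^ 'n" where
    vA: "\<And>i j. sesqui A (v i) (v j) = (if i = j then 1 else 0)"
    and vB: "\<And>i j. i \<noteq> j \<Longrightarrow> sesqui B (v i) (v j) = 0"
    using exists_partial_diagonalizing_family[OF A hB, of UNIV] by auto
  define d where "d i = Re (sesqui B (v i) (v i))" for i
  define V :: "complex ^ 'n ^ 'n" where "V = (\<chi> i j. v j $ i)"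
  have VMV: "(conj_transpose V ** (M ** V)) $ i $ j = sesqui M (v i) (v j)" for M i j
    by (simp add: sesqui_altdef V_def matrix_matrix_mult_def conj_transpose_nth
        sum_distrib_left mult.assoc)
  have VA: "conj_transpose V ** (A ** V) = diag_mat (\<lambda>_. 1)"
    by (simp add: vec_eq_iff VMV vA diag_mat_def)
  have "sesqui B (v i) (v i) = of_real (d i)" for i
    unfolding d_def by (rule sesqui_self_real[OF hB])
  then have VB: "conj_transpose V ** (B ** V) = diag_mat d"
    by (simp add: vec_eq_iff VMV vB diag_mat_def)
  define S where "S = conj_transpose V ** A"
  have SV: "S ** V = mat 1" using VA by (simp add: S_def diag_mat_1 matrix_mul_assoc)
  then have VS: "V ** S = mat 1" by (rule matrix_left_right_inverse[THEN iffD1])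
  have SV': "conj_transpose S ** conj_transpose V = mat 1"
    by (simp add: VS conj_transpose_mat_1 flip: conj_transpose_mult)
  have recover: "M = congruent_diag S c" if "conj_transpose V ** (M ** V) = diag_mat c" for M c
  proof -
    have "congruent_diag S c = (conj_transpose S ** conj_transpose V) ** M ** (V ** S)"
      unfolding congruent_diag_def that[symmetric] by (simp only: matrix_mul_assoc)
    then show ?thesis by (simp add: SV' VS)
  qed
  have "d i > 0" for i
  proof -
    have "v i \<noteq> 0" using vA[of i i] by (auto simp: sesqui_altdef)
    then show ?thesis unfolding d_def by (rule posB)
  qed
  then show ?thesis by (rule that[OF VS recover[OF VA] recover[OF VB]])
qed

section \<open>Means of simultaneously diagonalized matrices\<close>

lemma harmonic_mean_congruent_diag:
  assumes VS: "V ** S = mat 1" and d: "\<And>i. d i > 0" and t: "0 \<le> t" "t \<le> 1"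
  shows "harmonic_mean t (congruent_diag S (\<lambda>_. 1)) (congruent_diag S d)
    = congruent_diag S (\<lambda>i. 1 / (1 - t + t / d i))"
proof -
  have d0: "d i \<noteq> 0" for i using d[of i] by simp
  have pos: "1 - t + t / d i > 0" for i
    using t d[of i] by (cases "t = 1") (auto intro!: add_pos_nonneg)
  have VS': "conj_transpose S ** conj_transpose V = mat 1"
    by (simp add: VS conj_transpose_mat_1 flip: conj_transpose_mult)
  have pos': "1 - t + t / d i \<noteq> 0" for i using pos[of i] by simp
  show ?thesis
    using matrix_inv_congruent_diag[OF VS', of "\<lambda>i. 1 - t + t / d i"] pos'
    by (simp add: harmonic_mean_def matrix_inv_congruent_diag[OF VS] d0
        congruent_diag_scaleR congruent_diag_add conj_transpose_conj_transpose)
qed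

text \<open>
  The two denominators of the harmonic means of \<open>1\<close> and \<open>x\<close> with weights \<open>t\<close> and \<open>1 - t\<close> add up
  to \<open>1 + x\<close>, and their product is \<open>x + t (1 - t) (x - 1)\<^sup>2\<close>. In this form the mean depends on
  \<open>t\<close> only through \<open>t (1 - t)\<close>, and its comparison with the arithmetic mean is immediate.
\<close>
lemma harmonic_heinz_mean_congruent_diag:
  assumes "V ** S = mat 1" and d: "\<And>i. d i > 0" and t: "0 \<le> t" "t \<le> 1"
  shows "harmonic_heinz_mean t (congruent_diag S (\<lambda>_. 1)) (congruent_diag S d)
    = congruent_diag S (\<lambda>i. (1 + d i) / 2 * (d i / (d i + t * (1 - t) * (d i - 1)\<^sup>2)))"
proof -
  have "1 / 2 * (1 / (1 - t + t / d i) + 1 / (1 - (1 - t) + (1 - t) / d i))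
      = (1 + d i) / 2 * (d i / (d i + t * (1 - t) * (d i - 1)\<^sup>2))" for i
  proof -
    define x where "x = d i"
    have x: "x > 0" using d by (simp add: x_def)
    have p: "(1 - t) * x + t > 0"
      using t x by (cases "t = 0") (auto intro!: add_nonneg_pos)
    have q: "t * x + (1 - t) > 0"
      using t x by (cases "t = 1") (auto intro!: add_nonneg_pos)
    have pq: "x + t * (1 - t) * (x - 1)\<^sup>2 = ((1 - t) * x + t) * (t * x + (1 - t))"
      by (simp add: power2_eq_square algebra_simps)
    have p': "1 / (1 - t + t / x) = x / ((1 - t) * x + t)"
      using x by (simp add: field_simps)
    have q': "1 / (1 - (1 - t) + (1 - t) / x) = x / (t * x + (1 - t))"
      using x by (simp add: field_simps)
    have "1 / 2 * (x / P + x / Q) = (1 + x) / 2 * (x / (P * Q))"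
      if "P > 0" "Q > 0" "P + Q = 1 + x" for P Q :: real
      using that by (simp add: field_simps flip: that(3))
    from this[OF p q] show ?thesis
      unfolding x_def[symmetric] p' q' pq by (simp add: algebra_simps)
  qed
  then show ?thesis
    using assms by (simp add: harmonic_heinz_mean_def harmonic_mean_congruent_diag
        congruent_diag_add congruent_diag_scaleR)
qed

lemma arith_mean_congruent_diag:
  "arith_mean (congruent_diag S (\<lambda>_. 1)) (congruent_diag S d) = congruent_diag S (\<lambda>i. (1 + d i) / 2)"
  by (simp add: arith_mean_def congruent_diag_add congruent_diag_scaleR)

section \<open>The scalar inequality and geometric means\<close>

text \<open>
  After division by the arithmetic mean, the gap for a parameter \<open>u\<close> is \<open>u q / (x + u q)\<close> with
  \<open>q = (x - 1)\<^sup>2\<close>, and \<open>q / (x + u q)\<close> is nonincreasing in \<open>u\<close> for \<open>u \<ge> 0\<close>.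
\<close>
lemma arith_harmonic_heinz_gap_antimono:
  fixes x s \<sigma> :: real
  assumes "x > 0" "0 \<le> s" "s \<le> \<sigma>" "\<sigma> > 0"
  shows "(1 + x) / 2 * (x / (x + s * (x - 1)\<^sup>2))
      + s / \<sigma> * ((1 + x) / 2 - (1 + x) / 2 * (x / (x + \<sigma> * (x - 1)\<^sup>2))) \<le> (1 + x) / 2"
proof -
  define q where "q = (x - 1)\<^sup>2"
  have q: "q \<ge> 0" by (simp add: q_def)
  have p: "x + s * q > 0" "x + \<sigma> * q > 0" using assms q by (auto intro!: add_pos_nonneg)
  have gap: "1 - x / (x + u * q) = u * (q / (x + u * q))" if "x + u * q > 0" for u
    using that by (simp add: field_simps)
  have "s / \<sigma> * (1 - x / (x + \<sigma> * q)) = s * (q / (x + \<sigma> * q))"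
    unfolding gap[OF p(2)] using assms by simp
  also have "\<dots> \<le> s * (q / (x + s * q))"
    using assms q p by (intro mult_left_mono divide_left_mono add_left_mono mult_right_mono) auto
  also have "\<dots> = 1 - x / (x + s * q)" using gap[OF p(1)] by simp
  finally have "x / (x + s * q) + s / \<sigma> * (1 - x / (x + \<sigma> * q)) \<le> 1" by simp
  then have "(1 + x) / 2 * (x / (x + s * q) + s / \<sigma> * (1 - x / (x + \<sigma> * q))) \<le> (1 + x) / 2"
    using assms(1) by (intro mult_left_le) auto
  moreover have "m * (a + c * (1 - b)) = m * a + c * (m - m * b)" for m a b c :: real
    by (simp add: algebra_simps)
  ultimately show ?thesis unfolding q_def[symmetric] by metis
qed

text \<open>
  Dividing by the right-hand side reduces the claim to the inequality of arithmetic and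
  geometric means for the ratios \<open>x i / z i\<close> and for the ratios \<open>y i / z i\<close>: the two
  arithmetic means add up to at most \<open>1\<close>.
\<close>
lemma root_prod_superadditive:
  fixes x y z :: "'n::finite \<Rightarrow> real"
  assumes x: "\<And>i. 0 \<le> x i" and y: "\<And>i. 0 \<le> y i" and z: "\<And>i. 0 < z i"
    and le: "\<And>i. x i + y i \<le> z i"
  shows "root CARD('n) (\<Prod>i\<in>UNIV. x i) + root CARD('n) (\<Prod>i\<in>UNIV. y i)
    \<le> root CARD('n) (\<Prod>i\<in>UNIV. z i)"
proof -
  let ?n = "CARD('n)"
  define Z where "Z = root ?n (\<Prod>i\<in>UNIV. z i)"
  have Z: "Z > 0" unfolding Z_def using z by (intro real_root_gt_zero prod_pos) auto
  have amgm: "root ?n (\<Prod>i\<in>UNIV. w i) / Z \<le> (\<Sum>i\<in>UNIV. w i / z i) / ?n"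
    if w: "\<And>i. 0 \<le> w i" for w
  proof -
    have "root ?n (\<Prod>i\<in>UNIV. w i) / Z = root ?n (\<Prod>i\<in>UNIV. w i / z i)"
      by (simp add: Z_def real_root_divide prod_dividef)
    also have "\<dots> \<le> (\<Sum>i\<in>UNIV. w i / z i) / ?n"
      using arith_geom_mean[of UNIV "\<lambda>i. w i / z i"] w z
      by (simp add: less_imp_le root_powr_inverse prod_nonneg flip: sum_divide_distrib
          divide_divide_eq_left)
    finally show ?thesis .
  qed
  have "root ?n (\<Prod>i\<in>UNIV. x i) / Z + root ?n (\<Prod>i\<in>UNIV. y i) / Z
      \<le> (\<Sum>i\<in>UNIV. (x i + y i) / z i) / ?n"
    using add_mono[OF amgm[of x] amgm[of y]] x y
    by (simp add: add_divide_distrib sum.distrib)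
  also have "\<dots> \<le> (\<Sum>i\<in>(UNIV::'n set). 1) / ?n"
    using z le by (intro divide_right_mono sum_mono) auto
  also have "\<dots> = 1" by simp
  finally show ?thesis using Z by (simp add: Z_def[symmetric] field_simps)
qed

text \<open>
  The hypothesis makes the factors of \<open>\<tau> (1 - \<tau>) - t (1 - t) = (\<tau> - t) (1 - \<tau> - t)\<close> both
  nonnegative or both nonpositive.
\<close>
lemma weight_product_mono:
  assumes "t \<le> r_min \<tau> \<or> t \<ge> R_max \<tau>"
  shows "t * (1 - t) \<le> \<tau> * (1 - \<tau>)"
proof -
  have "\<tau> * (1 - \<tau>) - t * (1 - t) = (\<tau> - t) * (1 - \<tau> - t)"
    by (simp add: algebra_simps)
  also have "\<dots> \<ge> 0"
    using assms by (auto simp: r_min_def R_max_def intro: mult_nonneg_nonneg mult_nonpos_nonpos)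
  finally show ?thesis by simp
qed

section \<open>The determinant inequality\<close>

theorem theorem3p4:
  fixes A B :: "complex ^ 'n ^ 'n" and t \<tau> :: real
  assumes "pos_definite A" and "pos_definite B"
    and "0 < \<tau>" and "\<tau> < 1" and "0 \<le> t" and "t \<le> 1"
    and "t \<le> r_min \<tau> \<or> t \<ge> R_max \<tau>"
  shows "det_root (arith_mean A B) \<ge>
    det_root (harmonic_heinz_mean t A B)
      + t * (1 - t) / (\<tau> * (1 - \<tau>))
        * det_root (arith_mean A B - harmonic_heinz_mean \<tau> A B)"
proof -
  obtain S V d where VS: "V ** S = mat 1" and A: "A = congruent_diag S (\<lambda>_. 1)"
    and B: "B = congruent_diag S d" and d: "\<And>i. d i > 0"
    using simultaneous_diagonalization[OF assms(1,2)] by blast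
  define s where "s = t * (1 - t)"
  define \<sigma> where "\<sigma> = \<tau> * (1 - \<tau>)"
  have s: "0 \<le> s" "s \<le> \<sigma>" "\<sigma> > 0"
    using assms weight_product_mono[OF assms(7)] by (auto simp: s_def \<sigma>_def)
  define z where "z i = (1 + d i) / 2" for i
  define h where "h u i = z i * (d i / (d i + u * (d i - 1)\<^sup>2))" for u i
  define g where "g i = s / \<sigma> * (z i - h \<sigma> i)" for i
  have mean: "arith_mean A B = congruent_diag S z"
    unfolding A B arith_mean_congruent_diag z_def ..
  have heinz: "harmonic_heinz_mean t A B = congruent_diag S (h s)"
    "harmonic_heinz_mean \<tau> A B = congruent_diag S (h \<sigma>)"
    unfolding A B h_def z_def s_def \<sigma>_def
    using harmonic_heinz_mean_congruent_diag[OF VS d] assms by simp_all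
  have z: "z i > 0" for i using d[of i] by (simp add: z_def)
  have h: "0 \<le> h u i" "h u i \<le> z i" if "u \<ge> 0" for u i
  proof -
    have pos: "d i + u * (d i - 1)\<^sup>2 > 0" using d[of i] that by (intro add_pos_nonneg) auto
    then show "0 \<le> h u i" unfolding h_def using d[of i] z[of i] by simp
    have "d i / (d i + u * (d i - 1)\<^sup>2) \<le> 1" using pos that by (simp add: field_simps)
    from mult_left_mono[OF this, of "z i"] show "h u i \<le> z i"
      unfolding h_def using z[of i] by simp
  qed
  \<comment> \<open>The factor moves into the product, so that superadditivity applies to \<open>h s + g \<le> z\<close>.\<close>
  have "(\<Prod>i\<in>UNIV. g i) = (s / \<sigma>) ^ CARD('n) * (\<Prod>i\<in>UNIV. z i - h \<sigma> i)"
    unfolding g_def prod.distrib by simp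
  then have g: "root CARD('n) (\<Prod>i\<in>UNIV. g i)
      = s / \<sigma> * root CARD('n) (\<Prod>i\<in>UNIV. z i - h \<sigma> i)"
    using s by (simp add: real_root_mult real_root_power_cancel)
  have "root CARD('n) (\<Prod>i\<in>UNIV. h s i) + root CARD('n) (\<Prod>i\<in>UNIV. g i)
      \<le> root CARD('n) (\<Prod>i\<in>UNIV. z i)"
  proof (rule root_prod_superadditive)
    show "h s i + g i \<le> z i" for i
      unfolding g_def h_def z_def
      using arith_harmonic_heinz_gap_antimono[OF d s] .
    show "0 \<le> g i" for i
      unfolding g_def using s h(2)[of \<sigma> i] by simp
  qed (use h s z in auto)
  from mult_left_mono[OF this, of "root CARD('n) ((cmod (det S))\<^sup>2)"]
  have "det_root (congruent_diag S (h s))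
      + s / \<sigma> * det_root (congruent_diag S (\<lambda>i. z i - h \<sigma> i))
      \<le> det_root (congruent_diag S z)"
    unfolding det_root_congruent_diag g by (simp add: algebra_simps)
  then show ?thesis
    unfolding mean heinz congruent_diag_diff s_def \<sigma>_def .
qed

end
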